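(* For every positive integer $r$, as formal power series in $q$, \[\sum_{n=0}^{\infty}\sigma_r\overline{\mathrm{mex}}(n)\,q^n = \frac{(-q;q)_\infty\,(q^{2r};q^{2r})_\infty}{(q;q)_\infty\,(q^{r};q^{2r})_\infty}.\]
   Context: $(a;q)_\infty=\prod_{j\ge 0}(1-aq^j)$. An overpartition of $n$ is a non-increasing sequence of positive integers summing to $n$ in which the first occurrence of each distinct part may be overlined (the empty overpartition is the unique overpartition of $0$). For a positive integer $r$ and an overpartition $\pi$, the least $r$-gap $\overline{\mathrm{mex}}_r(\pi)$ is the smallest positive integer that appears fewer than $r$ times among the non-overlined parts of $\pi$. Then $\sigma_r\overline{\mathrm{mex}}(n)=\sum_{\pi}\overline{\mathrm{mex}}_r(\pi)$, summed over all overpartitions $\pi$ of $n$. *)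

theory Defs
  imports "HOL-Analysis.Analysis" "HOL-Computational_Algebra.Formal_Power_Series"
begin

text \<open>
  A part is a pair of its size and a flag that is \<^const>\<open>True\<close> iff the part is overlined.
  The last condition says that only the first occurrence of a size may be overlined.
\<close>
definition overpartition :: "nat \<Rightarrow> (nat \<times> bool) list \<Rightarrow> bool" where
  "overpartition n \<pi> \<longleftrightarrow>
     sorted_wrt (\<ge>) (map fst \<pi>) \<and>
     (\<forall>p\<in>set \<pi>. fst p > 0) \<and>
     sum_list (map fst \<pi>) = n \<and>
     (\<forall>i<length \<pi>. snd (\<pi> ! i) \<longrightarrow> (\<forall>j<i. fst (\<pi> ! j) \<noteq> fst (\<pi> ! i)))"

lemma finite_overpartitions: "finite {\<pi>. overpartition n \<pi>}"
proof (rule finite_subset)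
  have len: "length \<pi> \<le> sum_list (map fst \<pi>)"
    if "\<forall>p\<in>set \<pi>. fst p > 0" for \<pi> :: "(nat \<times> bool) list"
    using that by (induction \<pi>) (auto simp: Suc_le_eq)
  have le: "fst p \<le> sum_list (map fst \<pi>)"
    if "p \<in> set \<pi>" for p and \<pi> :: "(nat \<times> bool) list"
    using that by (intro member_le_sum_list) auto
  show "{\<pi>. overpartition n \<pi>} \<subseteq> {\<pi>. set \<pi> \<subseteq> {..n} \<times> UNIV \<and> length \<pi> \<le> n}"
    using len le by (auto simp: overpartition_def)
  show "finite {\<pi>. set \<pi> \<subseteq> {..n} \<times> (UNIV :: bool set) \<and> length \<pi> \<le> n}"
    by (intro finite_lists_length_le finite_cartesian_product) auto
qed

definition mex_over :: "nat \<Rightarrow> (nat \<times> bool) list \<Rightarrow> nat" where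
  "mex_over r \<pi> = (LEAST k. k > 0 \<and> count_list \<pi> (k, False) < r)"

definition sigma_mex_over :: "nat \<Rightarrow> nat \<Rightarrow> nat" where
  "sigma_mex_over r n = (\<Sum>\<pi> | overpartition n \<pi>. mex_over r \<pi>)"

text \<open>
  The infinite product is taken in the \<^const>\<open>fps_X\<close>-adic topology of \<^typ>\<open>rat fps\<close>; the
  arguments are themselves power series, such as \<^term>\<open>- fps_X :: rat fps\<close>.
\<close>
definition qpochhammer_inf :: "rat fps \<Rightarrow> rat fps \<Rightarrow> rat fps" where
  "qpochhammer_inf a q = (\<Prod>j. 1 - a * q ^ j)"

end

theory Submission
  imports Defs
begin

text \<open>
  Since the least gap exceeds $k$ iff each of $1, \dots, k$ occurs at least $r$ times non-overlined,
  summing over $k$ gives the generating function $\sum_k q^{r k (k + 1) / 2}$ times that of all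
  overpartitions, which is $(-q;q)_\infty / (q;q)_\infty$.  Gauss's identity
  $\sum_k q^{k (k + 1) / 2} = (q^2;q^2)_\infty / (q;q^2)_\infty$, with $q^r$ for $q$, then finishes the
  proof.  Gauss's identity is the limit of a finite identity of Shanks, proved by telescoping.
\<close>

unbundle no vec_syntax and fps_syntax

section \<open>Convergence of power series\<close>

text \<open>Coefficient \<open>n\<close> of a product depends only on the coefficients up to
  \<open>n\<close> of the factors, and these finitely many are eventually constant.\<close>

lemma tendsto_mult_fps:
  fixes F G :: "'a::ring fps"
  assumes "(f \<longlongrightarrow> F) A" "(g \<longlongrightarrow> G) A"
  shows "((\<lambda>x. f x * g x) \<longlongrightarrow> F * G) A"
proof (rule tendsto_fpsI)
  fix n
  have "eventually (\<lambda>x. \<forall>i\<in>{..n}. f x $ i = F $ i) A" "eventually (\<lambda>x. \<forall>i\<in>{..n}. g x $ i = G $ i) A"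
    using assms by (auto simp: tendsto_fps_iff eventually_ball_finite_distrib)
  then show "eventually (\<lambda>x. (f x * g x) $ n = (F * G) $ n) A"
    by eventually_elim (auto simp: fps_mult_nth intro!: sum.cong)
qed

text \<open>Multiplying by \<open>f j\<close> leaves the coefficients up to \<open>j\<close> alone,
  so coefficient \<open>n\<close> of the partial products is fixed once \<open>n\<close> factors are
  present.\<close>

lemma tendsto_prodinf_fps:
  fixes f :: "nat \<Rightarrow> 'a::idom fps"
  assumes f: "\<And>i j. i \<le> j \<Longrightarrow> f j $ i = 1 $ i"
  shows "(\<lambda>N. \<Prod>k<N. f k) \<longlonglongrightarrow> prodinf f" "prodinf f \<noteq> 0"
proof -
  have step: "(\<Prod>k<Suc j. f k) $ i = (\<Prod>k<j. f k) $ i" if "i \<le> j" for i j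
  proof -
    have "((\<Prod>k<j. f k) * f j) $ i = ((\<Prod>k<j. f k) * 1) $ i"
      unfolding fps_mult_nth using that f by (intro sum.cong) auto
    then show ?thesis by (simp add: mult.commute)
  qed
  have stable: "(\<Prod>k<n + d. f k) $ n = (\<Prod>k<n. f k) $ n" for n d
    by (induction d) (use step in auto)
  define P where "P = Abs_fps (\<lambda>n. (\<Prod>k<n. f k) $ n)"
  have P: "(\<lambda>N. \<Prod>k<N. f k) \<longlonglongrightarrow> P"
  proof (rule tendsto_fpsI)
    fix n
    show "eventually (\<lambda>N. (\<Prod>k<N. f k) $ n = P $ n) sequentially"
      using eventually_ge_at_top[of n]
    proof eventually_elim
      case (elim N)
      then show ?case using stable[of n "N - n"] by (simp add: P_def)
    qed
  qed
  have "P $ 0 = 1" by (simp add: P_def)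
  then have "P \<noteq> 0" by auto
  \<comment> \<open>A convergent infinite product must have a nonzero limit; here the constant
    coefficient 1 ensures it.\<close>
  then have "raw_has_prod f 0 P"
    using P by (simp add: raw_has_prod_def LIMSEQ_lessThan_iff_atMost)
  then have "prodinf f = P"
    using has_prod_unique[of f P] by (simp add: has_prod_def)
  then show "(\<lambda>N. \<Prod>k<N. f k) \<longlonglongrightarrow> prodinf f" "prodinf f \<noteq> 0"
    using P \<open>P \<noteq> 0\<close> by auto
qed

text \<open>As \<open>fps_X\<close> divides both \<open>a\<close> and \<open>q\<close>, the factor
  with index \<open>j\<close> is 1 modulo \<open>fps_X ^ Suc j\<close>.\<close>

lemma tendsto_qpochhammer_inf:
  assumes "a $ 0 = 0" "q $ 0 = 0"
  shows "(\<lambda>N. \<Prod>k<N. 1 - a * q ^ k) \<longlonglongrightarrow> qpochhammer_inf a q" "qpochhammer_inf a q \<noteq> 0"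
proof -
  have "(1 - a * q ^ j) $ i = 1 $ i" if "i \<le> j" for i j
  proof -
    have "a = fps_X * fps_shift 1 a" "q = fps_X * fps_shift 1 q"
      using assms by (auto intro!: fps_ext)
    then have "fps_X dvd a" "fps_X dvd q"
      by (metis dvd_triv_left)+
    then have "fps_X ^ Suc j dvd a * q ^ j"
      by (simp add: mult_dvd_mono dvd_power_same)
    then show ?thesis
      using that by (auto simp: dvd_def fps_X_power_mult_nth simp del: power_Suc)
  qed
  from tendsto_prodinf_fps[OF this]
  show "(\<lambda>N. \<Prod>k<N. 1 - a * q ^ k) \<longlonglongrightarrow> qpochhammer_inf a q" "qpochhammer_inf a q \<noteq> 0"
    unfolding qpochhammer_inf_def by auto
qed

section \<open>Shanks's finite form of Gauss's identity\<close>

text \<open>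
  Shanks's summand is $P_n / P_s \cdot q^{s (2 n + 1)}$ with
  $P_n = \prod_{k < n} (1 - q^{2 k + 2}) / (1 - q^{2 k + 1})$; everything is multiplied by
  the denominator of $P_n$, so that the identity holds in every commutative ring.
\<close>

definition shanks :: "'a::comm_ring_1 \<Rightarrow> nat \<Rightarrow> nat \<Rightarrow> 'a" where
  "shanks q n s = (\<Prod>k\<in>{s..<n}. 1 - q ^ (2 * k + 2)) * (\<Prod>k<s. 1 - q ^ (2 * k + 1))"

lemma shanks_shift:
  assumes "s < n"
  shows "(1 - q ^ (2 * s + 2)) * shanks q n (Suc s) = (1 - q ^ (2 * s + 1)) * shanks q n s"
  using assms by (simp add: shanks_def prod.atLeast_Suc_lessThan algebra_simps)

lemma shanks_Suc:
  assumes "s \<le> n"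
  shows "shanks q (Suc n) s = (1 - q ^ (2 * n + 2)) * shanks q n s"
  using assms by (simp add: shanks_def algebra_simps)

text \<open>The factor \<open>1 - q ^ (2 * n + 1)\<close> brings the summands for \<open>n\<close>
  to the denominator used for \<open>n + 1\<close>. For \<open>m = n\<close> this compares two
  consecutive Shanks sums, leaving one boundary term.\<close>

lemma shanks_telescope:
  fixes q :: "'a::comm_ring_1"
  assumes "m \<le> n"
  shows "(\<Sum>s\<le>m. shanks q (Suc n) s * q ^ (s * (2 * n + 3)) -
            (1 - q ^ (2 * n + 1)) * (shanks q n s * q ^ (s * (2 * n + 1)))) =
         shanks q n m * (1 - q ^ (2 * m + 1)) * q ^ ((m + 1) * (2 * n + 1))"
  using assms
proof (induction m)
  case 0
  define k where "k = 2 * n"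
  show ?case by (simp add: shanks_Suc flip: k_def) (simp add: algebra_simps)
next
  case (Suc m)
  \<comment> \<open>In these variables the induction step is the ring identity (1 - y) F x + (1 - z
    q) F x y - (1 - z) F x = F (1 - y q) x z.\<close>
  define F where "F = shanks q n (Suc m)"
  define x where "x = q ^ (Suc m * (2 * n + 1))"
  define y where "y = q ^ (2 * Suc m)"
  define z where "z = q ^ (2 * n + 1)"
  have F: "shanks q (Suc n) (Suc m) = (1 - z * q) * F"
    "shanks q n m * (1 - q ^ (2 * m + 1)) = (1 - y) * F"
    using shanks_shift[of m n q] Suc.prems by (simp_all add: shanks_Suc F_def y_def z_def mult_ac)
  have exps: "q ^ (Suc m * (2 * n + 3)) = x * y" "q ^ ((Suc m + 1) * (2 * n + 1)) = x * z"
    "q ^ (2 * Suc m + 1) = y * q" "q ^ ((m + 1) * (2 * n + 1)) = x"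
    unfolding x_def y_def z_def power_add[symmetric] power_Suc2[symmetric]
    by (rule arg_cong[where f = "(^) q"], simp add: algebra_simps)+
  have IH: "(\<Sum>s\<le>m. shanks q (Suc n) s * q ^ (s * (2 * n + 3)) -
            (1 - q ^ (2 * n + 1)) * (shanks q n s * q ^ (s * (2 * n + 1)))) = (1 - y) * F * x"
    using Suc.IH Suc.prems by (simp only: F exps Suc_leD)
  show ?case
    unfolding sum.atMost_Suc IH
    unfolding F exps F_def[symmetric] x_def[symmetric] z_def[symmetric]
    by (simp add: algebra_simps)
qed

text \<open>Passing from \<open>n\<close> to \<open>n + 1\<close> adds two triangular exponents:
  that of index \<open>2 * n\<close> is the term \<open>s = n\<close>, which the sum for
  \<open>n\<close> lacks, and that of index \<open>2 * n + 1\<close> is the boundary term of the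
  telescoping.\<close>

lemma shanks_identity:
  fixes q :: "'a::comm_ring_1"
  shows "(\<Sum>s<n. shanks q n s * q ^ (s * (2 * n + 1))) =
    (\<Sum>k<2 * n. q ^ (\<Sum>{..k})) * (\<Prod>k<n. 1 - q ^ (2 * k + 1))"
proof (induction n)
  case (Suc n)
  let ?O = "1 - q ^ (2 * n + 1)"
  have T: "\<Sum>{..2 * n} = n * (2 * n + 1)" "\<Sum>{..Suc (2 * n)} = (n + 1) * (2 * n + 1)"
    by (induction n) auto
  have "(\<Sum>s\<le>n. shanks q (Suc n) s * q ^ (s * (2 * n + 3))) =
      ?O * (\<Sum>s\<le>n. shanks q n s * q ^ (s * (2 * n + 1))) +
      shanks q n n * ?O * q ^ ((n + 1) * (2 * n + 1))"
    using shanks_telescope[of n n q] unfolding sum_subtractf sum_distrib_left[symmetric]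
    by (simp add: diff_eq_eq add.commute)
  also have "(\<Sum>s\<le>n. shanks q n s * q ^ (s * (2 * n + 1))) =
      (\<Sum>s<n. shanks q n s * q ^ (s * (2 * n + 1))) + shanks q n n * q ^ (n * (2 * n + 1))"
    by (simp flip: lessThan_Suc_atMost)
  also note Suc.IH
  also have "shanks q n n = (\<Prod>k<n. 1 - q ^ (2 * k + 1))"
    by (simp add: shanks_def)
  finally have *: "(\<Sum>s\<le>n. shanks q (Suc n) s * q ^ (s * (2 * n + 3))) =
     (\<Prod>k<n. 1 - q ^ (2 * k + 1)) * ?O *
       ((\<Sum>k<2 * n. q ^ (\<Sum>{..k})) + q ^ (\<Sum>{..2 * n}) + q ^ (\<Sum>{..Suc (2 * n)}))"
    unfolding T by (simp only: algebra_simps)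
  have "(\<Sum>k<2 * Suc n. q ^ (\<Sum>{..k})) =
      (\<Sum>k<2 * n. q ^ (\<Sum>{..k})) + q ^ (\<Sum>{..2 * n}) + q ^ (\<Sum>{..Suc (2 * n)})"
    by (simp only: mult_Suc_right add_2_eq_Suc sum.lessThan_Suc)
  moreover have "(\<Prod>k<Suc n. 1 - q ^ (2 * k + 1)) = (\<Prod>k<n. 1 - q ^ (2 * k + 1)) * ?O"
    by simp
  moreover have "2 * Suc n + 1 = 2 * n + 3" by simp
  ultimately show ?case
    using * by (simp only: lessThan_Suc_atMost mult_ac)
qed simp

text \<open>Every summand with \<open>s > 0\<close> is divisible by a power of \<open>fps_X\<close>
  that grows with \<open>n\<close>, so only \<open>s = 0\<close> survives, and it is a partial
  product of the limit.\<close>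

lemma tendsto_shanks_sum:
  assumes r: "r > 0"
  shows "(\<lambda>n. \<Sum>s<n. shanks (fps_X ^ r) n s * (fps_X ^ r) ^ (s * (2 * n + 1)))
    \<longlonglongrightarrow> qpochhammer_inf (fps_X ^ (2 * r)) (fps_X ^ (2 * r))"
proof (rule tendsto_fpsI)
  fix i :: nat
  let ?q = "fps_X ^ r :: rat fps" and ?E = "fps_X ^ (2 * r) :: rat fps"
  have "(\<lambda>N. \<Prod>k<N. 1 - ?E * ?E ^ k) \<longlonglongrightarrow> qpochhammer_inf ?E ?E"
    using r by (intro tendsto_qpochhammer_inf) auto
  then have "eventually (\<lambda>n. (\<Prod>k<n. 1 - ?E * ?E ^ k) $ i = qpochhammer_inf ?E ?E $ i) sequentially"
    by (simp add: tendsto_fps_iff)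
  then show "eventually (\<lambda>n. (\<Sum>s<n. shanks ?q n s * ?q ^ (s * (2 * n + 1))) $ i =
      qpochhammer_inf ?E ?E $ i) sequentially"
    using eventually_gt_at_top[of i]
  proof eventually_elim
    case (elim n)
    have "(shanks ?q n s * ?q ^ (s * (2 * n + 1))) $ i = 0" if "s \<noteq> 0" for s
    proof -
      have "1 * n \<le> (r * s) * (2 * n + 1)"
        using that r by (intro mult_mono) (auto simp: Suc_le_eq)
      then have "i < r * (s * (2 * n + 1))"
        using elim by (simp add: algebra_simps)
      then show ?thesis
        by (simp only: fps_X_power_mult_right_nth flip: power_mult) simp
    qed
    then have "(\<Sum>s<n. shanks ?q n s * ?q ^ (s * (2 * n + 1))) $ i = shanks ?q n 0 $ i"
      using elim by (subst fps_sum_nth, subst sum.remove[of _ 0]) auto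
    also have "shanks ?q n 0 = (\<Prod>k<n. 1 - ?E * ?E ^ k)"
      by (auto simp: shanks_def atLeast0LessThan algebra_simps simp flip: power_mult power_add
          intro!: prod.cong)
    finally show ?case using elim by simp
  qed
qed

section \<open>Overpartitions with prescribed minimal multiplicities\<close>

abbreviation weight :: "(nat \<times> bool) list \<Rightarrow> nat" where
  "weight \<pi> \<equiv> sum_list (map fst \<pi>)"

lemma overpartition_Nil: "overpartition n [] \<longleftrightarrow> n = 0"
  by (auto simp: overpartition_def)

text \<open>Taking the weight as the total makes the sum condition automatic. A later part as large
  as the head is not the first of its size, so it cannot be overlined.\<close>

lemma overpartition_Cons:
  "overpartition (weight (x # \<pi>)) (x # \<pi>) \<longleftrightarrow>
     fst x > 0 \<and> (\<forall>p\<in>set \<pi>. fst p \<le> fst x \<and> (snd p \<longrightarrow> fst p \<noteq> fst x)) \<and> overpartition (weight \<pi>) \<pi>"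
proof -
  have "(\<forall>i<length (x # \<pi>). snd ((x # \<pi>) ! i) \<longrightarrow> (\<forall>j<i. fst ((x # \<pi>) ! j) \<noteq> fst ((x # \<pi>) ! i))) \<longleftrightarrow>
    (\<forall>p\<in>set \<pi>. snd p \<longrightarrow> fst p \<noteq> fst x) \<and>
    (\<forall>i<length \<pi>. snd (\<pi> ! i) \<longrightarrow> (\<forall>j<i. fst (\<pi> ! j) \<noteq> fst (\<pi> ! i)))"
    unfolding all_set_conv_all_nth length_Cons All_less_Suc2 nth_Cons_Suc nth_Cons_0
    by (simp add: eq_commute[of "fst x"] imp_conjR all_conj_distrib)
  then show ?thesis
    unfolding overpartition_def by auto
qed

definition weight_gf :: "(nat \<times> bool) list set \<Rightarrow> rat fps" where
  "weight_gf A = Abs_fps (\<lambda>n. of_nat (card {\<pi> \<in> A. weight \<pi> = n}))"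

text \<open>Infinite sets have \<open>card\<close> 0; consisting of overpartitions makes each weight
  class finite, so that cardinalities add.\<close>

lemma weight_gf_Un:
  assumes "A \<subseteq> {\<pi>. overpartition (weight \<pi>) \<pi>}" "B \<subseteq> {\<pi>. overpartition (weight \<pi>) \<pi>}" "A \<inter> B = {}"
  shows "weight_gf (A \<union> B) = weight_gf A + weight_gf B"
proof (rule fps_ext)
  fix n
  have "finite {\<pi> \<in> A. weight \<pi> = n}" "finite {\<pi> \<in> B. weight \<pi> = n}"
    using assms by (auto intro!: finite_subset[OF _ finite_overpartitions[of n]])
  moreover have "{\<pi> \<in> A \<union> B. weight \<pi> = n} = {\<pi> \<in> A. weight \<pi> = n} \<union> {\<pi> \<in> B. weight \<pi> = n}"
    by auto
  ultimately show "weight_gf (A \<union> B) $ n = (weight_gf A + weight_gf B) $ n"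
    using assms(3) by (simp add: weight_gf_def) (subst card_Un_disjoint; auto)
qed

lemma weight_gf_Cons: "weight_gf (Cons x ` A) = fps_X ^ fst x * weight_gf A"
proof (rule fps_ext)
  fix n
  have "{\<pi> \<in> Cons x ` A. weight \<pi> = n} =
      (if n < fst x then {} else Cons x ` {\<pi> \<in> A. weight \<pi> = n - fst x})"
    by auto
  then show "weight_gf (Cons x ` A) $ n = (fps_X ^ fst x * weight_gf A) $ n"
    by (auto simp: weight_gf_def fps_X_power_mult_nth card_image)
qed

text \<open>With \<open>c\<close> equal to \<open>r\<close> up to \<open>k\<close> and 0 beyond, the
  last condition will express that the least gap exceeds \<open>k\<close>. The bound
  \<open>m\<close> is the recursion parameter.\<close>

definition bounded_ops :: "(nat \<Rightarrow> nat) \<Rightarrow> nat \<Rightarrow> (nat \<times> bool) list set" where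
  "bounded_ops c m = {\<pi>. overpartition (weight \<pi>) \<pi> \<and> (\<forall>p\<in>set \<pi>. fst p \<le> m) \<and>
     (\<forall>i\<in>{1..m}. c i \<le> count_list \<pi> (i, False))}"

text \<open>
  These interpolate between \<^term>\<open>bounded_ops c m\<close> and \<^term>\<open>bounded_ops c (Suc m)\<close>, so that every
  step of the recursion removes a single leading part.
\<close>

definition plain_top_ops :: "(nat \<Rightarrow> nat) \<Rightarrow> nat \<Rightarrow> nat \<Rightarrow> (nat \<times> bool) list set" where
  "plain_top_ops c m j = {\<pi>. overpartition (weight \<pi>) \<pi> \<and> (\<forall>p\<in>set \<pi>. fst p \<le> Suc m) \<and>
     (Suc m, True) \<notin> set \<pi> \<and> j \<le> count_list \<pi> (Suc m, False) \<and>
     (\<forall>i\<in>{1..m}. c i \<le> count_list \<pi> (i, False))}"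

lemma overpartition_head_max:
  assumes "overpartition (weight (x # \<pi>)) (x # \<pi>)" "\<forall>p\<in>set (x # \<pi>). fst p \<le> m" "(m, b) \<in> set (x # \<pi>)"
  shows "fst x = m"
proof -
  have "m \<le> fst x"
    using assms(1,3) unfolding overpartition_Cons by (auto dest: bspec[of _ _ "(m, b)"])
  then show ?thesis using assms(2) by (simp add: antisym)
qed

text \<open>A required copy of the largest size stands at the head, where it can be removed.\<close>

lemma plain_top_ops_Suc: "plain_top_ops c m (Suc j) = Cons (Suc m, False) ` plain_top_ops c m j"
proof (intro equalityI subsetI)
  fix \<pi> assume \<pi>: "\<pi> \<in> plain_top_ops c m (Suc j)"
  then have "count_list \<pi> (Suc m, False) \<noteq> 0"
    by (auto simp: plain_top_ops_def)
  then have "(Suc m, False) \<in> set \<pi>"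
    by (simp add: count_list_0_iff)
  then obtain x \<rho> where x: "\<pi> = x # \<rho>" by (cases \<pi>) auto
  have "fst x = Suc m"
    using \<pi> \<open>(Suc m, False) \<in> set \<pi>\<close> overpartition_head_max[of x \<rho> "Suc m" False]
    unfolding plain_top_ops_def x by blast
  moreover have "x \<noteq> (Suc m, True)"
    using \<pi> unfolding plain_top_ops_def x by auto
  ultimately have "x = (Suc m, False)" by (cases x) auto
  then show "\<pi> \<in> Cons (Suc m, False) ` plain_top_ops c m j"
    using \<pi> unfolding plain_top_ops_def x mem_Collect_eq overpartition_Cons by fastforce
next
  fix \<pi> assume "\<pi> \<in> Cons (Suc m, False) ` plain_top_ops c m j"
  then show "\<pi> \<in> plain_top_ops c m (Suc j)"
    unfolding plain_top_ops_def by (auto simp del: list.map sum_list.Cons simp: overpartition_Cons)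
qed

lemma plain_top_ops_0:
  "plain_top_ops c m 0 = bounded_ops c m \<union> plain_top_ops c m (Suc 0)"
proof -
  have "fst p \<le> m" if "fst p \<le> Suc m" "(Suc m, True) \<notin> set \<pi>" "(Suc m, False) \<notin> set \<pi>" "p \<in> set \<pi>"
    for p \<pi>
    using that by (cases p; cases "snd p") (auto simp: le_Suc_eq)
  then show ?thesis
    unfolding plain_top_ops_def bounded_ops_def
    by (fastforce simp: Suc_le_eq count_list_0_iff simp flip: neq0_conv)
qed

text \<open>An overlined part of the largest size is the first of that size, hence the head. The two
  cases produce the factor \<open>1 + fps_X ^ Suc m\<close>.\<close>

lemma bounded_ops_Suc:
  "bounded_ops c (Suc m) = plain_top_ops c m (c (Suc m)) \<union>
     Cons (Suc m, True) ` plain_top_ops c m (c (Suc m))"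
proof (intro equalityI subsetI)
  fix \<pi> assume \<pi>: "\<pi> \<in> bounded_ops c (Suc m)"
  show "\<pi> \<in> plain_top_ops c m (c (Suc m)) \<union> Cons (Suc m, True) ` plain_top_ops c m (c (Suc m))"
  proof (cases "(Suc m, True) \<in> set \<pi>")
    case True
    then obtain x \<rho> where x: "\<pi> = x # \<rho>" by (cases \<pi>) auto
    have "fst x = Suc m"
      using \<pi> True overpartition_head_max[of x \<rho> "Suc m" True]
      unfolding bounded_ops_def x by blast
    then have "(Suc m, True) \<notin> set \<rho>"
      using \<pi> unfolding bounded_ops_def x mem_Collect_eq overpartition_Cons by fastforce
    moreover from this have head: "x = (Suc m, True)" using True x by auto
    moreover have "count_list \<pi> (i, False) = count_list \<rho> (i, False)" for i
      by (simp add: x head)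
    ultimately have "\<rho> \<in> plain_top_ops c m (c (Suc m))"
      using \<pi> unfolding bounded_ops_def plain_top_ops_def x mem_Collect_eq overpartition_Cons
      by simp
    then show ?thesis by (simp add: x head)
  next
    case False
    then show ?thesis using \<pi> unfolding bounded_ops_def plain_top_ops_def by auto
  qed
next
  fix \<pi> assume "\<pi> \<in> plain_top_ops c m (c (Suc m)) \<union> Cons (Suc m, True) ` plain_top_ops c m (c (Suc m))"
  then show "\<pi> \<in> bounded_ops c (Suc m)"
    unfolding bounded_ops_def plain_top_ops_def
    by (auto simp del: list.map sum_list.Cons simp: overpartition_Cons le_Suc_eq)
qed

text \<open>For \<open>j = 0\<close>, either size \<open>Suc m\<close> is absent or one copy can be
  removed: a geometric series in equation form. Each further required copy contributes
  \<open>fps_X ^ Suc m\<close>.\<close>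

lemma weight_gf_plain_top_ops:
  "weight_gf (plain_top_ops c m j) * (1 - fps_X ^ Suc m) =
     fps_X ^ (Suc m * j) * weight_gf (bounded_ops c m)"
proof (induction j)
  case 0
  have "bounded_ops c m \<inter> plain_top_ops c m (Suc 0) = {}"
    by (auto simp: bounded_ops_def plain_top_ops_def Suc_le_eq count_list_0_iff simp flip: neq0_conv)
  then have "weight_gf (plain_top_ops c m 0) =
      weight_gf (bounded_ops c m) + weight_gf (plain_top_ops c m (Suc 0))"
    by (subst plain_top_ops_0, intro weight_gf_Un) (auto simp: bounded_ops_def plain_top_ops_def)
  then show ?case
    by (simp add: plain_top_ops_Suc weight_gf_Cons algebra_simps)
next
  case (Suc j)
  then show ?case
    by (simp add: plain_top_ops_Suc weight_gf_Cons power_add mult.assoc)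
qed

text \<open>Each size \<open>i\<close> contributes q^(i c_i) (1 + q^i) / (1 - q^i); the denominators
  are cleared.\<close>

lemma weight_gf_bounded_ops:
  "weight_gf (bounded_ops c m) * (\<Prod>k<m. 1 - fps_X ^ Suc k) =
     fps_X ^ (\<Sum>i=1..m. i * c i) * (\<Prod>k<m. 1 + fps_X ^ Suc k)"
proof (induction m)
  case 0
  have "bounded_ops c 0 = {[]}"
  proof -
    have "\<pi> = []" if "overpartition n \<pi>" "\<forall>p\<in>set \<pi>. fst p = 0" for n \<pi>
      using that by (cases \<pi>) (auto simp: overpartition_def)
    then show ?thesis by (auto simp: bounded_ops_def overpartition_Nil)
  qed
  then have "weight_gf (bounded_ops c 0) = 1"
    by (intro fps_ext) (auto simp: weight_gf_def Collect_conv_if)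
  then show ?case by simp
next
  case (Suc m)
  let ?D = "plain_top_ops c m (c (Suc m))" and ?X = "fps_X ^ Suc m :: rat fps"
  have "weight_gf (bounded_ops c (Suc m)) = weight_gf ?D + weight_gf (Cons (Suc m, True) ` ?D)"
    unfolding bounded_ops_Suc
  proof (rule weight_gf_Un)
    have "bounded_ops c (Suc m) \<subseteq> {\<pi>. overpartition (weight \<pi>) \<pi>}"
      by (auto simp: bounded_ops_def)
    then show "?D \<subseteq> {\<pi>. overpartition (weight \<pi>) \<pi>}"
      "Cons (Suc m, True) ` ?D \<subseteq> {\<pi>. overpartition (weight \<pi>) \<pi>}"
      unfolding bounded_ops_Suc by blast+
    show "?D \<inter> Cons (Suc m, True) ` ?D = {}"
      by (auto simp: plain_top_ops_def)
  qed
  then have "weight_gf (bounded_ops c (Suc m)) * (1 - ?X) = (1 + ?X) * (weight_gf ?D * (1 - ?X))"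
    by (simp add: weight_gf_Cons algebra_simps)
  also note weight_gf_plain_top_ops
  finally have top: "weight_gf (bounded_ops c (Suc m)) * (1 - ?X) =
      (1 + ?X) * (fps_X ^ (Suc m * c (Suc m)) * weight_gf (bounded_ops c m))" .
  have "weight_gf (bounded_ops c (Suc m)) * (\<Prod>k<Suc m. 1 - fps_X ^ Suc k) =
      weight_gf (bounded_ops c (Suc m)) * (1 - ?X) * (\<Prod>k<m. 1 - fps_X ^ Suc k)"
    by (simp only: prod.lessThan_Suc mult_ac)
  also have "\<dots> = (1 + ?X) * fps_X ^ (Suc m * c (Suc m)) *
      (weight_gf (bounded_ops c m) * (\<Prod>k<m. 1 - fps_X ^ Suc k))"
    by (simp only: top mult.assoc)
  also note Suc.IH
  also have "(1 + ?X) * fps_X ^ (Suc m * c (Suc m)) *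
      (fps_X ^ (\<Sum>i=1..m. i * c i) * (\<Prod>k<m. 1 + fps_X ^ Suc k)) =
      fps_X ^ (\<Sum>i=1..Suc m. i * c i) * (\<Prod>k<Suc m. 1 + fps_X ^ Suc k)"
    by (simp add: power_add mult_ac del: power_Suc mult_Suc)
  finally show ?case .
qed

section \<open>The least gap\<close>

text \<open>The counted \<open>k\<close> are exactly those below the least gap, with 0 counted
  vacuously. The range \<open>{..<N}\<close> holds them all because the least gap is at most
  \<open>n + 1\<close>.\<close>

lemma mex_over_eq_card:
  assumes "overpartition n \<pi>" "r > 0" "n < N"
  shows "mex_over r \<pi> = card {k \<in> {..<N}. \<forall>i\<in>{1..k}. r \<le> count_list \<pi> (i, False)}"
proof -
  let ?P = "\<lambda>k. k > 0 \<and> count_list \<pi> (k, False) < r"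
  have "fst p \<le> n" if "p \<in> set \<pi>" for p
    using assms(1) that member_le_sum_list[of "fst p" "map fst \<pi>"] by (auto simp: overpartition_def)
  then have "(Suc n, False) \<notin> set \<pi>" by fastforce
  \<comment> \<open>A part of size \<open>n + 1\<close> does not fit into an overpartition of
    \<open>n\<close>, so a gap exists and \<open>LEAST\<close> is attained.\<close>
  then have P: "?P (Suc n)" using assms(2) by simp
  then have "?P (mex_over r \<pi>)" "mex_over r \<pi> \<le> Suc n"
    unfolding mex_over_def by (rule LeastI, rule Least_le)
  moreover have "r \<le> count_list \<pi> (i, False)" if "0 < i" "i < mex_over r \<pi>" for i
    using that not_less_Least[of i ?P] unfolding mex_over_def by auto
  moreover have "k < mex_over r \<pi>"
    if "\<forall>i\<in>{1..k}. r \<le> count_list \<pi> (i, False)" "?P (mex_over r \<pi>)" for k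
  proof (rule ccontr)
    assume "\<not> k < mex_over r \<pi>"
    then have "mex_over r \<pi> \<in> {1..k}" using that(2) by auto
    then show False using that by fastforce
  qed
  ultimately have "{k \<in> {..<N}. \<forall>i\<in>{1..k}. r \<le> count_list \<pi> (i, False)} = {..<mex_over r \<pi>}"
    using assms(3) by auto
  then show ?thesis by simp
qed

text \<open>Interchange the sums over overpartitions and over \<open>k\<close>. Since
  \<open>n < N\<close>, every overpartition of \<open>n\<close> satisfies the bound \<open>N\<close>
  on its parts.\<close>

lemma sigma_mex_over_eq:
  assumes "r > 0" "n < N"
  shows "sigma_mex_over r n =
    (\<Sum>k<N. card {\<pi> \<in> bounded_ops (\<lambda>i. if i \<le> k then r else 0) N. weight \<pi> = n})"
proof -
  let ?P = "\<lambda>\<pi> k. \<forall>i\<in>{1..k}. r \<le> count_list \<pi> (i, False)"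
  have "sigma_mex_over r n = (\<Sum>\<pi> | overpartition n \<pi>. \<Sum>k<N. of_bool (?P \<pi> k))"
    unfolding sigma_mex_over_def
    by (intro sum.cong refl) (use assms mex_over_eq_card in \<open>auto simp: Int_def\<close>)
  also have "\<dots> = (\<Sum>k<N. \<Sum>\<pi> | overpartition n \<pi>. of_bool (?P \<pi> k))"
    by (rule sum.swap)
  also have "\<dots> = (\<Sum>k<N. card {\<pi> \<in> bounded_ops (\<lambda>i. if i \<le> k then r else 0) N. weight \<pi> = n})"
  proof (intro sum.cong refl)
    fix k assume "k \<in> {..<N}"
    have "fst p \<le> N" if "overpartition n \<pi>" "p \<in> set \<pi>" for p \<pi>
      using that assms(2) member_le_sum_list[of "fst p" "map fst \<pi>"] by (auto simp: overpartition_def)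
    moreover have "overpartition n \<pi> \<longleftrightarrow> overpartition (weight \<pi>) \<pi> \<and> weight \<pi> = n" for \<pi>
      by (auto simp: overpartition_def)
    moreover have "(\<forall>i\<in>{1..N}. (if i \<le> k then r else 0) \<le> count_list \<pi> (i, False)) \<longleftrightarrow> ?P \<pi> k" for \<pi>
      using \<open>k \<in> {..<N}\<close> by auto
    ultimately have "{\<pi>. overpartition n \<pi>} \<inter> {\<pi>. ?P \<pi> k} =
        {\<pi> \<in> bounded_ops (\<lambda>i. if i \<le> k then r else 0) N. weight \<pi> = n}"
      unfolding bounded_ops_def by blast
    then show "(\<Sum>\<pi> | overpartition n \<pi>. of_bool (?P \<pi> k)) =
        card {\<pi> \<in> bounded_ops (\<lambda>i. if i \<le> k then r else 0) N. weight \<pi> = n}"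
      using finite_overpartitions by simp
  qed
  finally show ?thesis .
qed

lemma sum_weight_gf_bounded_ops:
  "(\<Sum>k<N. weight_gf (bounded_ops (\<lambda>i. if i \<le> k then r else 0) N)) * (\<Prod>k<N. 1 - fps_X ^ Suc k) =
     (\<Sum>k<N. (fps_X ^ r) ^ \<Sum>{..k}) * (\<Prod>k<N. 1 + fps_X ^ Suc k)"
proof -
  \<comment> \<open>The \<open>r\<close> forced copies of each of 1, ..., \<open>k\<close> weigh
    \<open>r\<close> times a triangular number.\<close>
  have "(\<Sum>i=1..N. i * (if i \<le> k then r else 0)) = r * \<Sum>{..k}" if "k < N" for k
  proof -
    have "(\<Sum>i=1..N. i * (if i \<le> k then r else 0)) = (\<Sum>i\<le>k. i * r)"
      using that by (intro sum.mono_neutral_cong) auto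
    then show ?thesis by (simp add: sum_distrib_left mult.commute)
  qed
  then show ?thesis
    unfolding sum_distrib_right by (intro sum.cong)
      (auto simp: weight_gf_bounded_ops power_mult simp del: power_Suc)
qed

theorem theorem1p4:
  fixes r :: nat
  assumes "r > 0"
  shows "Abs_fps (\<lambda>n. of_nat (sigma_mex_over r n)) =
    (qpochhammer_inf (- fps_X) fps_X * qpochhammer_inf (fps_X ^ (2 * r)) (fps_X ^ (2 * r))) /
    (qpochhammer_inf fps_X fps_X * qpochhammer_inf (fps_X ^ r) (fps_X ^ (2 * r)))"
proof -
  let ?L = "Abs_fps (\<lambda>n. of_nat (sigma_mex_over r n)) :: rat fps"
  let ?q = "fps_X ^ r :: rat fps"
  let ?R = "qpochhammer_inf (- fps_X) fps_X" and ?Q = "qpochhammer_inf fps_X fps_X"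
  let ?E = "qpochhammer_inf (fps_X ^ (2 * r)) (fps_X ^ (2 * r))"
  let ?O = "qpochhammer_inf (fps_X ^ r) (fps_X ^ (2 * r))"
  \<comment> \<open>\<open>G N\<close> has the same coefficients as \<open>?L\<close> at all indices
    below \<open>N\<close>.\<close>
  define G where "G N = (\<Sum>k<N. weight_gf (bounded_ops (\<lambda>i. if i \<le> k then r else 0) N))" for N
  \<comment> \<open>Shanks's identity at \<open>n\<close> involves \<open>2 * n\<close> triangular
    powers, so the overpartition side is taken along even \<open>N\<close>.\<close>
  have double: "(\<lambda>n. f (2 * n)) \<longlonglongrightarrow> F" if "f \<longlonglongrightarrow> F" for f and F :: "rat fps"
    using LIMSEQ_subseq_LIMSEQ[OF that, of "\<lambda>n. 2 * n"] by (simp add: strict_mono_def o_def)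
  have "G \<longlonglongrightarrow> ?L"
  proof (rule tendsto_fpsI)
    fix n
    show "eventually (\<lambda>N. G N $ n = ?L $ n) sequentially"
      using eventually_gt_at_top[of n]
      by eventually_elim (simp add: G_def fps_sum_nth weight_gf_def sigma_mex_over_eq[OF assms])
  qed
  moreover have Q: "(\<lambda>N. \<Prod>k<N. 1 - fps_X ^ Suc k) \<longlonglongrightarrow> ?Q" "?Q \<noteq> 0"
    using tendsto_qpochhammer_inf[of fps_X fps_X] by auto
  moreover have R: "(\<lambda>N. \<Prod>k<N. 1 + fps_X ^ Suc k) \<longlonglongrightarrow> ?R"
    using tendsto_qpochhammer_inf[of "-fps_X" fps_X] by auto
  moreover have O: "(\<lambda>N. \<Prod>k<N. 1 - ?q ^ (2 * k + 1)) \<longlonglongrightarrow> ?O" "?O \<noteq> 0"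
    using tendsto_qpochhammer_inf[of ?q "fps_X ^ (2 * r)"] assms
    by (auto simp: algebra_simps simp flip: power_mult power_add)
  ultimately have "(\<lambda>n. G (2 * n) * (\<Prod>k<2 * n. 1 - fps_X ^ Suc k) * (\<Prod>k<n. 1 - ?q ^ (2 * k + 1)))
      \<longlonglongrightarrow> ?L * ?Q * ?O"
    by (intro tendsto_mult_fps double)
  \<comment> \<open>The odd product clears the denominator of Shanks's sum, so both finite
    identities combine without division.\<close>
  moreover have "G (2 * n) * (\<Prod>k<2 * n. 1 - fps_X ^ Suc k) * (\<Prod>k<n. 1 - ?q ^ (2 * k + 1)) =
      (\<Prod>k<2 * n. 1 + fps_X ^ Suc k) * (\<Sum>s<n. shanks ?q n s * ?q ^ (s * (2 * n + 1)))" for n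
    unfolding G_def sum_weight_gf_bounded_ops shanks_identity by (simp only: mult_ac)
  moreover have "(\<lambda>n. (\<Prod>k<2 * n. 1 + fps_X ^ Suc k) * (\<Sum>s<n. shanks ?q n s * ?q ^ (s * (2 * n + 1))))
      \<longlonglongrightarrow> ?R * ?E"
    by (intro tendsto_mult_fps double R tendsto_shanks_sum assms)
  ultimately have "?L * (?Q * ?O) = ?R * ?E"
    by (simp add: LIMSEQ_unique mult.assoc)
  \<comment> \<open>Only after the limit is the equation divided, by a nonzero series.\<close>
  moreover have "?Q * ?O \<noteq> 0" using Q O by simp
  ultimately show ?thesis
    by (metis nonzero_mult_div_cancel_right)
qed

end
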